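(* Let $G$ be a countable group and let $G\curvearrowright(X,\mu)$ be a nonsingular ergodic partial action on a standard probability space. The following are equivalent: 1. If $G\curvearrowright(X,\mu)$ is induced from $H\curvearrowright Y$ and $h\in H\setminus\{e\}$ is such that $Y_{h^{-1}}$ has nonzero measure and $h$ acts trivially on $Y$, then $h$ has infinite $H$-conjugacy class, i.e. $\{khk^{-1}: k\in H\}$ is infinite. 2. The groupoid $G\ltimes X$ is icc.
   Context: Partial actions. A partial action $G\curvearrowright_\sigma X$ of a countable group $G$ on a standard Borel space $X$ is a collection of Borel sets $X_g\subset X$ ($g\in G$) and Borel bijections $\sigma_g:X_{g^{-1}}\to X_g$ such that $\sigma_e=\mathrm{id}_X$ and, for all $g,h\in G$, $\sigma_{gh}$ extends the composition $\sigma_g\circ\sigma_h$ (defined on all $x\in X_{h^{-1}}$ with $\sigma_h(x)\in X_{g^{-1}}$). Write $g\cdot x=\sigma_g(x)$. Its groupoid is $G\ltimes X=\{(g,x): g\in G,x\in X_{g^{-1}}\}$ with unit space $X$ (identified with $\{e\}\times X$), $s(g,x)=x$, $t(g,x)=g\cdot x$, $(g,h\cdot x)(h,x)=(gh,x)$. If $\mu$ is a probability measure on $X$, the partial action is nonsingular (ergodic) if $(G\ltimes X,\mu)$ is a nonsingular discrete measured groupoid, i.e. the measures $\mu_s(A)=\int_X|A\cap s^{-1}(x)|\,d\mu(x)$ and $\mu_t(A)=\int_X|A\cap t^{-1}(x)|\,d\mu(x)$ are equivalent (respectively if the orbit equivalence relation $\{(t(a),s(a)): a\in G\ltimes X\}$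 is ergodic). For a Borel set $Y\subset X$, the restricted partial action $G\curvearrowright Y$ has $Y_g=\{x\in X_g: x\in Y,\ \sigma_{g^{-1}}(x)\in Y\}$ and $\sigma_g$ restricted to $Y_{g^{-1}}\to Y_g$; its groupoid $G\ltimes Y$ equals $\{a\in G\ltimes X: s(a),t(a)\in Y\}$. For a subgroup $H\le G$, $H\ltimes Y=\{(h,y): h\in H, y\in Y_{h^{-1}}\}$. $Y$ is $H$-invariant if $h\cdot(Y\cap X_{h^{-1}})=Y\cap X_h$ for all $h\in H$. $Y$ is $\mu$-full if $t(\{a\in G\ltimes X: s(a)\in Y\})$ is $\mu$-conull in $X$. For a subgroup $H\le G$ and an $H$-invariant Borel subset $Y\subset X$, $G\curvearrowright(X,\mu)$ is induced from $H\curvearrowright Y$ if $Y$ is $\mu$-full in $G\ltimes X$ and $G\ltimes Y=H\ltimes Y$. An element $h$ acts trivially on $Y$ if $h\cdot y=y$ for all $y\in Y_{h^{-1}}$. Icc. For $\mathcal{G}=G\ltimes X$, let $\mathrm{Iso}(\mathcal{G})=\{a: s(a)=t(a)\}$, and for Borel $A\subset\mathrm{Iso}(\mathcal{G})$ let $\Omega_A=\{bab^{-1}: a\in A,b\in\mathcal{G},s(b)=t(a)\}$. A bisection is a subset on which $s$ and $t$ are injective. $\mathcal{G}$ is icc if every Borel bisection $A\subset\mathrm{Iso}(\mathcal{G})$ with $\mu_s(A)>0$ and $\mu_s(\Omega_A)<\infty$ is contained in the unit space up to a $\mu_s$-null set. *)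

theory Defs
  imports "HOL-Probability.Probability" "HOL-Algebra.Group"
begin

definition standard_borel :: "'x measure \<Rightarrow> bool" where
  "standard_borel M \<longleftrightarrow>
     (\<exists>T. completely_metrizable_space T \<and> second_countable T \<and> topspace T = space M \<and>
          sets M = sigma_sets (space M) {U. openin T U})"

text \<open>
  For a partial action \<open>P\<close>, the set \<open>X\<^sub>g\<close> is \<open>pdom P g\<close>, so that \<open>\<sigma>\<^sub>g = pact P g\<close> is a map from
  \<open>pdom P (inv g)\<close> to \<open>pdom P g\<close>; its values outside \<open>pdom P (inv g)\<close> are irrelevant.
\<close>

record ('g, 'x) paction =
  pdom :: "'g \<Rightarrow> 'x set"
  pact :: "'g \<Rightarrow> 'x \<Rightarrow> 'x"

definition partial_action ::
  "('g, 'm) monoid_scheme \<Rightarrow> 'x measure \<Rightarrow> ('g, 'x) paction \<Rightarrow> bool" where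
  "partial_action G M P \<longleftrightarrow>
     (\<forall>g\<in>carrier G. pdom P g \<in> sets M) \<and>
     (\<forall>g\<in>carrier G.
        bij_betw (pact P g) (pdom P (inv\<^bsub>G\<^esub> g)) (pdom P g) \<and>
        pact P g \<in> measurable (restrict_space M (pdom P (inv\<^bsub>G\<^esub> g))) (restrict_space M (pdom P g))) \<and>
     pdom P \<one>\<^bsub>G\<^esub> = space M \<and>
     (\<forall>x\<in>space M. pact P \<one>\<^bsub>G\<^esub> x = x) \<and>
     (\<forall>g\<in>carrier G. \<forall>h\<in>carrier G. \<forall>x\<in>pdom P (inv\<^bsub>G\<^esub> h).
        pact P h x \<in> pdom P (inv\<^bsub>G\<^esub> g) \<longrightarrow>
          x \<in> pdom P (inv\<^bsub>G\<^esub> (g \<otimes>\<^bsub>G\<^esub> h)) \<and>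
          pact P (g \<otimes>\<^bsub>G\<^esub> h) x = pact P g (pact P h x))"

definition prestrict ::
  "('g, 'm) monoid_scheme \<Rightarrow> ('g, 'x) paction \<Rightarrow> 'x set \<Rightarrow> ('g, 'x) paction" where
  "prestrict G P Y =
     \<lparr>pdom = (\<lambda>g. {x \<in> pdom P g. x \<in> Y \<and> pact P (inv\<^bsub>G\<^esub> g) x \<in> Y}), pact = pact P\<rparr>"

text \<open>
  \<open>pgroupoid G P H\<close> is \<open>H \<ltimes> X\<close> for a subset \<open>H\<close> of \<open>G\<close>. The full groupoid \<open>G \<ltimes> X\<close> is the case
  \<open>H = carrier G\<close>, and \<open>H \<ltimes> Y\<close> is \<open>pgroupoid G (prestrict G P Y) H\<close>.
\<close>

definition pgroupoid ::
  "('g, 'm) monoid_scheme \<Rightarrow> ('g, 'x) paction \<Rightarrow> 'g set \<Rightarrow> ('g \<times> 'x) set" where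
  "pgroupoid G P H = {(g, x). g \<in> H \<and> x \<in> pdom P (inv\<^bsub>G\<^esub> g)}"

definition gsrc :: "'g \<times> 'x \<Rightarrow> 'x" where
  "gsrc a = snd a"

definition gtgt :: "('g, 'x) paction \<Rightarrow> 'g \<times> 'x \<Rightarrow> 'x" where
  "gtgt P a = pact P (fst a) (snd a)"

text \<open>The product below is only meaningful when \<open>gsrc a = gtgt P b\<close>.\<close>

definition gmult :: "('g, 'm) monoid_scheme \<Rightarrow> 'g \<times> 'x \<Rightarrow> 'g \<times> 'x \<Rightarrow> 'g \<times> 'x" where
  "gmult G a b = (fst a \<otimes>\<^bsub>G\<^esub> fst b, snd b)"

definition ginv :: "('g, 'm) monoid_scheme \<Rightarrow> ('g, 'x) paction \<Rightarrow> 'g \<times> 'x \<Rightarrow> 'g \<times> 'x" where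
  "ginv G P a = (inv\<^bsub>G\<^esub> (fst a), gtgt P a)"

definition gunits :: "('g, 'm) monoid_scheme \<Rightarrow> 'x measure \<Rightarrow> ('g \<times> 'x) set" where
  "gunits G M = {\<one>\<^bsub>G\<^esub>} \<times> space M"

definition gborel ::
  "('g, 'm) monoid_scheme \<Rightarrow> 'x measure \<Rightarrow> ('g, 'x) paction \<Rightarrow> ('g \<times> 'x) set set" where
  "gborel G M P =
     sets (restrict_space (count_space (carrier G) \<Otimes>\<^sub>M M) (pgroupoid G P (carrier G)))"

definition mu_s :: "'x measure \<Rightarrow> ('g \<times> 'x) set \<Rightarrow> ennreal" where
  "mu_s M A = (\<integral>\<^sup>+ x. emeasure (count_space UNIV) {a \<in> A. gsrc a = x} \<partial>M)"

definition mu_t :: "'x measure \<Rightarrow> ('g, 'x) paction \<Rightarrow> ('g \<times> 'x) set \<Rightarrow> ennreal" where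
  "mu_t M P A = (\<integral>\<^sup>+ x. emeasure (count_space UNIV) {a \<in> A. gtgt P a = x} \<partial>M)"

definition nonsingular_paction ::
  "('g, 'm) monoid_scheme \<Rightarrow> 'x measure \<Rightarrow> ('g, 'x) paction \<Rightarrow> bool" where
  "nonsingular_paction G M P \<longleftrightarrow> (\<forall>A\<in>gborel G M P. mu_s M A = 0 \<longleftrightarrow> mu_t M P A = 0)"

definition orbit_rel ::
  "('g, 'm) monoid_scheme \<Rightarrow> ('g, 'x) paction \<Rightarrow> ('x \<times> 'x) set" where
  "orbit_rel G P = (\<lambda>a. (gtgt P a, gsrc a)) ` pgroupoid G P (carrier G)"

definition ergodic_rel :: "'x measure \<Rightarrow> ('x \<times> 'x) set \<Rightarrow> bool" where
  "ergodic_rel M R \<longleftrightarrow>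
     (\<forall>E\<in>sets M. (\<forall>(x, y)\<in>R. x \<in> E \<longleftrightarrow> y \<in> E) \<longrightarrow>
        E \<in> null_sets M \<or> space M - E \<in> null_sets M)"

definition ergodic_paction ::
  "('g, 'm) monoid_scheme \<Rightarrow> 'x measure \<Rightarrow> ('g, 'x) paction \<Rightarrow> bool" where
  "ergodic_paction G M P \<longleftrightarrow> ergodic_rel M (orbit_rel G P)"

definition invariant_set ::
  "('g, 'm) monoid_scheme \<Rightarrow> ('g, 'x) paction \<Rightarrow> 'g set \<Rightarrow> 'x set \<Rightarrow> bool" where
  "invariant_set G P H Y \<longleftrightarrow>
     (\<forall>h\<in>H. pact P h ` (Y \<inter> pdom P (inv\<^bsub>G\<^esub> h)) = Y \<inter> pdom P h)"

definition full_set ::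
  "('g, 'm) monoid_scheme \<Rightarrow> 'x measure \<Rightarrow> ('g, 'x) paction \<Rightarrow> 'x set \<Rightarrow> bool" where
  "full_set G M P Y \<longleftrightarrow>
     (AE x in M. x \<in> gtgt P ` {a \<in> pgroupoid G P (carrier G). gsrc a \<in> Y})"

definition induced_from ::
  "('g, 'm) monoid_scheme \<Rightarrow> 'x measure \<Rightarrow> ('g, 'x) paction \<Rightarrow> 'g set \<Rightarrow> 'x set \<Rightarrow> bool" where
  "induced_from G M P H Y \<longleftrightarrow>
     subgroup H G \<and> Y \<in> sets M \<and> invariant_set G P H Y \<and> full_set G M P Y \<and>
     pgroupoid G (prestrict G P Y) (carrier G) = pgroupoid G (prestrict G P Y) H"

definition acts_trivially_on ::
  "('g, 'm) monoid_scheme \<Rightarrow> ('g, 'x) paction \<Rightarrow> 'g \<Rightarrow> 'x set \<Rightarrow> bool" where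
  "acts_trivially_on G P h Y \<longleftrightarrow> (\<forall>y\<in>pdom (prestrict G P Y) (inv\<^bsub>G\<^esub> h). pact P h y = y)"

definition giso ::
  "('g, 'm) monoid_scheme \<Rightarrow> ('g, 'x) paction \<Rightarrow> ('g \<times> 'x) set" where
  "giso G P = {a \<in> pgroupoid G P (carrier G). gsrc a = gtgt P a}"

definition gOmega ::
  "('g, 'm) monoid_scheme \<Rightarrow> ('g, 'x) paction \<Rightarrow> ('g \<times> 'x) set \<Rightarrow> ('g \<times> 'x) set" where
  "gOmega G P A =
     {gmult G (gmult G b a) (ginv G P b) | a b.
        a \<in> A \<and> b \<in> pgroupoid G P (carrier G) \<and> gsrc b = gtgt P a}"

definition bisection :: "('g, 'x) paction \<Rightarrow> ('g \<times> 'x) set \<Rightarrow> bool" where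
  "bisection P A \<longleftrightarrow> inj_on gsrc A \<and> inj_on (gtgt P) A"

definition icc_groupoid ::
  "('g, 'm) monoid_scheme \<Rightarrow> 'x measure \<Rightarrow> ('g, 'x) paction \<Rightarrow> bool" where
  "icc_groupoid G M P \<longleftrightarrow>
     (\<forall>A\<in>gborel G M P.
        A \<subseteq> giso G P \<and> bisection P A \<and> mu_s M A > 0 \<and> mu_s M (gOmega G P A) < \<infinity> \<longrightarrow>
          mu_s M (A - gunits G M) = 0)"

lemma pgroupoid_prestrict:
  assumes "group G" "partial_action G M P"
  shows "pgroupoid G (prestrict G P Y) (carrier G) =
           {a \<in> pgroupoid G P (carrier G). gsrc a \<in> Y \<and> gtgt P a \<in> Y}"
  using assms
  by (auto simp: pgroupoid_def prestrict_def gsrc_def gtgt_def group.inv_inv)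

end

theory Submission
  imports Defs
begin

text \<open>
  If \<open>\<Omega> = \<Omega>\<^sub>A\<close> has finite measure, then for almost every \<open>x\<close> the fibre \<open>\<Omega>\<^sub>x = {g. (g, x) \<in> \<Omega>}\<close> is a
  finite subset of \<open>G\<close>, and the map from \<open>x\<close> to \<open>\<Omega>\<^sub>x\<close> is equivariant for conjugation. As \<open>G\<close> has only
  countably many finite subsets, some \<open>Y = {x. \<Omega>\<^sub>x = F}\<close> meets a non-unit part of \<open>A\<close> in positive
  measure. By ergodicity the action is induced from \<open>H \<curvearrowright> Y\<close>, where \<open>H\<close> is the stabilizer of \<open>F\<close> under
  conjugation, and every element of \<open>F\<close> lies in \<open>H\<close>, acts trivially on \<open>Y\<close> and has its
  \<open>H\<close>-conjugacy class inside \<open>F\<close>. Conversely, if \<open>h\<close> acts trivially on \<open>Y\<close> and has a finite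
  \<open>H\<close>-conjugacy class, then \<open>A = {h} \<times> Y\<^bsub>h\<^sup>-\<^sup>1\<^esub>\<close> violates icc, because the fibres of \<open>\<Omega>\<^sub>A\<close> embed into
  conjugates of that class.
\<close>

locale countable_partial_action = group G for G (structure) +
  fixes M :: "'x measure" and P :: "('a, 'x) paction"
  assumes countable_carrier: "countable (carrier G)"
    and partial_action: "partial_action G M P"
begin

section \<open>Partial actions and Borel sets of arrows\<close>

lemma pdom_sets: "g \<in> carrier G \<Longrightarrow> pdom P g \<in> sets M"
  using partial_action by (auto simp: partial_action_def)

lemma pdom_one: "pdom P \<one> = space M"
  using partial_action by (auto simp: partial_action_def)

lemma pact_one: "x \<in> space M \<Longrightarrow> pact P \<one> x = x"
  using partial_action by (auto simp: partial_action_def)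

lemma pdom_space: "g \<in> carrier G \<Longrightarrow> x \<in> pdom P g \<Longrightarrow> x \<in> space M"
  using pdom_sets sets.sets_into_space by blast

lemma pact_mem: "g \<in> carrier G \<Longrightarrow> x \<in> pdom P (inv g) \<Longrightarrow> pact P g x \<in> pdom P g"
  using partial_action unfolding partial_action_def bij_betw_def by blast

lemma pact_mult:
  assumes "g \<in> carrier G" "h \<in> carrier G" "x \<in> pdom P (inv h)" "pact P h x \<in> pdom P (inv g)"
  shows "x \<in> pdom P (inv (g \<otimes> h))" "pact P (g \<otimes> h) x = pact P g (pact P h x)"
  using partial_action assms unfolding partial_action_def by blast+

lemma pact_measurable:
  "g \<in> carrier G \<Longrightarrow>
     pact P g \<in> measurable (restrict_space M (pdom P (inv g))) (restrict_space M (pdom P g))"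
  using partial_action by (auto simp: partial_action_def)

lemma pact_inv_mem: "g \<in> carrier G \<Longrightarrow> x \<in> pdom P g \<Longrightarrow> pact P (inv g) x \<in> pdom P (inv g)"
  using pact_mem[of "inv g" x] by simp

lemma pact_inv_pact: "g \<in> carrier G \<Longrightarrow> x \<in> pdom P (inv g) \<Longrightarrow> pact P (inv g) (pact P g x) = x"
  using pact_mult(2)[of "inv g" g x] pact_mem[of g x] pact_one[of x] pdom_space[of "inv g" x] by simp

lemma pact_pact_inv: "g \<in> carrier G \<Longrightarrow> x \<in> pdom P g \<Longrightarrow> pact P g (pact P (inv g) x) = x"
  using pact_inv_pact[of "inv g" x] by simp

text \<open>The image under \<open>pact P g\<close> is a preimage under
  \<open>pact P (inv g)\<close>, which is measurable by the axioms of a partial action.\<close>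

lemma pact_image_sets:
  assumes g: "g \<in> carrier G" and B: "B \<in> sets M"
  shows "pact P g ` (B \<inter> pdom P (inv g)) \<in> sets M"
proof -
  have "pact P g ` (B \<inter> pdom P (inv g)) =
      pact P (inv g) -` (B \<inter> pdom P (inv g)) \<inter> space (restrict_space M (pdom P g))"
  proof (intro equalityI subsetI)
    fix x assume "x \<in> pact P g ` (B \<inter> pdom P (inv g))"
    then show "x \<in> pact P (inv g) -` (B \<inter> pdom P (inv g)) \<inter> space (restrict_space M (pdom P g))"
      using g pact_mem pdom_space by (auto simp: space_restrict_space pact_inv_pact)
  next
    fix x assume x: "x \<in> pact P (inv g) -` (B \<inter> pdom P (inv g)) \<inter> space (restrict_space M (pdom P g))"
    then have "x = pact P g (pact P (inv g) x)"
      using g by (simp add: space_restrict_space pact_pact_inv)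
    then show "x \<in> pact P g ` (B \<inter> pdom P (inv g))"
      using x by blast
  qed
  also have "\<dots> \<in> sets (restrict_space M (pdom P g))"
  proof (rule measurable_sets)
    show "pact P (inv g) \<in> measurable (restrict_space M (pdom P g)) (restrict_space M (pdom P (inv g)))"
      using pact_measurable[of "inv g"] g by simp
    show "B \<inter> pdom P (inv g) \<in> sets (restrict_space M (pdom P (inv g)))"
      using B by (auto simp: sets_restrict_space)
  qed
  finally show ?thesis
    using pdom_sets[OF g] by (auto simp: sets_restrict_space)
qed

text \<open>For \<open>g\<close> outside \<open>carrier G\<close> the section is empty, so
  \<open>g\<close> may range over the whole type.\<close>

lemma gborel_section_sets:
  assumes A: "A \<in> gborel G M P"
  shows "{x. (g, x) \<in> A} \<in> sets M"
proof -
  obtain A' where A': "A' \<in> sets (count_space (carrier G) \<Otimes>\<^sub>M M)"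
      and eq: "A = pgroupoid G P (carrier G) \<inter> A'"
    using A by (auto simp: gborel_def sets_restrict_space)
  have "{x. (g, x) \<in> A} = (if g \<in> carrier G then pdom P (inv g) \<inter> Pair g -` A' else {})"
    by (auto simp: eq pgroupoid_def)
  then show ?thesis
    using sets_Pair1[OF A'] pdom_sets by auto
qed

lemma gborel_section:
  assumes g: "g \<in> carrier G" and B: "B \<in> sets M" "B \<subseteq> pdom P (inv g)"
  shows "{g} \<times> B \<in> gborel G M P"
proof -
  have "{g} \<times> B = pgroupoid G P (carrier G) \<inter> ({g} \<times> B)"
    using g B(2) by (auto simp: pgroupoid_def)
  moreover have "{g} \<times> B \<in> sets (count_space (carrier G) \<Otimes>\<^sub>M M)"
    using g B(1) by auto
  ultimately show ?thesis
    unfolding gborel_def sets_restrict_space by blast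
qed

lemma mult_inv_cancel: "g \<in> carrier G \<Longrightarrow> h \<in> carrier G \<Longrightarrow> g \<otimes> (inv g \<otimes> h) = h"
  by (simp add: m_assoc[symmetric])

section \<open>Conjugation of isotropy\<close>

text \<open>An isotropy arrow \<open>(h, y)\<close> has target \<open>y\<close>, so its conjugators
  are exactly the arrows \<open>(k, y)\<close>, and the conjugate has source
  \<open>pact P k y\<close>.\<close>

lemma gOmega_iff:
  assumes "A \<subseteq> giso G P"
  shows "(g, x) \<in> gOmega G P A \<longleftrightarrow>
    (\<exists>k\<in>carrier G. \<exists>h. \<exists>y\<in>pdom P (inv k). (h, y) \<in> A \<and> g = k \<otimes> h \<otimes> inv k \<and> x = pact P k y)"
proof
  assume "(g, x) \<in> gOmega G P A"
  then show "\<exists>k\<in>carrier G. \<exists>h. \<exists>y\<in>pdom P (inv k).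
      (h, y) \<in> A \<and> g = k \<otimes> h \<otimes> inv k \<and> x = pact P k y"
    using assms
    unfolding gOmega_def gmult_def ginv_def gtgt_def gsrc_def pgroupoid_def giso_def
    by fastforce
next
  assume "\<exists>k\<in>carrier G. \<exists>h. \<exists>y\<in>pdom P (inv k).
      (h, y) \<in> A \<and> g = k \<otimes> h \<otimes> inv k \<and> x = pact P k y"
  then obtain k h y where *: "k \<in> carrier G" "y \<in> pdom P (inv k)" "(h, y) \<in> A"
      "g = k \<otimes> h \<otimes> inv k" "x = pact P k y"
    by blast
  have "pact P h y = y"
    using * assms by (auto simp: giso_def gtgt_def gsrc_def)
  then show "(g, x) \<in> gOmega G P A"
    unfolding gOmega_def
    by (intro CollectI exI[of _ "(h, y)"] exI[of _ "(k, y)"])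
       (use * in \<open>auto simp: gmult_def ginv_def gtgt_def gsrc_def pgroupoid_def\<close>)
qed

lemma giso_iff: "(g, x) \<in> giso G P \<longleftrightarrow> g \<in> carrier G \<and> x \<in> pdom P (inv g) \<and> pact P g x = x"
  by (auto simp: giso_def pgroupoid_def gtgt_def gsrc_def)

text \<open>Starting from \<open>pact P k y\<close>, the elements \<open>inv k\<close>,
  \<open>h\<close> and \<open>k\<close> lead to \<open>y\<close>, again to \<open>y\<close>, and
  back. Each composition is defined, so the extension axiom applies twice.\<close>

lemma giso_conj:
  assumes "(h, y) \<in> giso G P" and k: "k \<in> carrier G" "y \<in> pdom P (inv k)"
  shows "(k \<otimes> h \<otimes> inv k, pact P k y) \<in> giso G P"
proof -
  have h: "h \<in> carrier G" "y \<in> pdom P (inv h)" "pact P h y = y"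
    using assms by (auto simp: giso_iff)
  have kh: "y \<in> pdom P (inv (k \<otimes> h))" "pact P (k \<otimes> h) y = pact P k y"
    using pact_mult[of k h y] h k by auto
  have "pact P k y \<in> pdom P (inv (k \<otimes> h \<otimes> inv k))"
    and "pact P (k \<otimes> h \<otimes> inv k) (pact P k y) = pact P k y"
    using pact_mult[of "k \<otimes> h" "inv k" "pact P k y"] h k kh by (auto simp: pact_mem pact_inv_pact)
  then show ?thesis
    using h k by (simp add: giso_iff)
qed

lemma gOmega_subset_giso: "A \<subseteq> giso G P \<Longrightarrow> gOmega G P A \<subseteq> giso G P"
  by (auto simp: gOmega_iff giso_conj subset_iff)

lemma subset_gOmega: "A \<subseteq> giso G P \<Longrightarrow> A \<subseteq> gOmega G P A"
proof
  fix a assume A: "A \<subseteq> giso G P" and a: "a \<in> A"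
  obtain g x where gx: "a = (g, x)" by fastforce
  have g: "g \<in> carrier G" "x \<in> space M"
    using A a pdom_space[of "inv g" x] by (auto simp: gx giso_iff subset_iff)
  then show "a \<in> gOmega G P A"
    unfolding gx gOmega_iff[OF A]
    by (intro bexI[of _ \<one>] exI[of _ g] bexI[of _ x]) (use a in \<open>auto simp: gx pdom_one pact_one\<close>)
qed

text \<open>Conjugating by \<open>l\<close> and then by \<open>k\<close> is conjugating by
  \<open>k \<otimes> l\<close>. This is the equivariance of the fibres of \<Omega>.\<close>

lemma gOmega_conj:
  assumes A: "A \<subseteq> giso G P" and "(g, x) \<in> gOmega G P A" and k: "k \<in> carrier G" "x \<in> pdom P (inv k)"
  shows "(k \<otimes> g \<otimes> inv k, pact P k x) \<in> gOmega G P A"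
proof -
  obtain l h y where *: "l \<in> carrier G" "y \<in> pdom P (inv l)" "(h, y) \<in> A"
      "g = l \<otimes> h \<otimes> inv l" "x = pact P l y"
    using assms by (auto simp: gOmega_iff)
  have "h \<in> carrier G"
    using * A by (auto simp: giso_iff subset_iff)
  then have "k \<otimes> g \<otimes> inv k = (k \<otimes> l) \<otimes> h \<otimes> inv (k \<otimes> l)"
    using * k by (simp add: inv_mult_group m_assoc)
  then show ?thesis
    unfolding gOmega_iff[OF A]
    using pact_mult[of k l y] * k
    by (intro bexI[of _ "k \<otimes> l"] exI[of _ h] bexI[of _ y]) auto
qed

text \<open>Countability of \<open>G\<close> makes the section a countable union, over conjugators
  \<open>k\<close> and elements \<open>h\<close>, of images of Borel sections of
  \<open>A\<close>.\<close>

lemma gOmega_section_sets: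
  assumes A: "A \<in> gborel G M P" "A \<subseteq> giso G P"
  shows "{x. (g, x) \<in> gOmega G P A} \<in> sets M"
proof -
  have "{x. (g, x) \<in> gOmega G P A} =
      (\<Union>k\<in>carrier G. \<Union>h\<in>{h\<in>carrier G. g = k \<otimes> h \<otimes> inv k}.
         pact P k ` ({y. (h, y) \<in> A} \<inter> pdom P (inv k)))"
    using A(2) by (fastforce simp: gOmega_iff[OF A(2)] giso_iff subset_iff)
  also have "\<dots> \<in> sets M"
    using countable_carrier
    by (auto intro!: sets.countable_UN' pact_image_sets gborel_section_sets A intro: countable_subset)
  finally show ?thesis .
qed

section \<open>A finite conjugacy class contradicts icc\<close>

lemma mu_s_section:
  assumes "B \<in> sets M"
  shows "mu_s M ({g} \<times> B) = emeasure M B"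
proof -
  have "emeasure (count_space UNIV) {a \<in> {g} \<times> B. gsrc a = x} = indicator B x" for x
  proof -
    have "{a \<in> {g} \<times> B. gsrc a = x} = (if x \<in> B then {(g, x)} else {})"
      by (auto simp: gsrc_def)
    then show ?thesis by simp
  qed
  then show ?thesis
    using assms by (simp add: mu_s_def)
qed

text \<open>The conjugators in the fibre of \<open>\<Omega>\<^sub>A\<close> over \<open>x\<close> lie in a single left coset \<open>k\<^sub>0H\<close>.\<close>

lemma mu_s_gOmega_section_le:
  assumes sub: "subgroup H G"
    and Y: "pgroupoid G (prestrict G P Y) (carrier G) \<subseteq> pgroupoid G (prestrict G P Y) H"
    and h: "h \<in> H" and B: "B \<subseteq> Y" "{h} \<times> B \<subseteq> giso G P"
    and fin: "finite {k \<otimes> h \<otimes> inv k | k. k \<in> H}"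
  shows "mu_s M (gOmega G P ({h} \<times> B)) \<le>
    of_nat (card {k \<otimes> h \<otimes> inv k | k. k \<in> H}) * emeasure M (space M)"
proof -
  let ?C = "{k \<otimes> h \<otimes> inv k | k. k \<in> H}"
  have hc: "h \<in> carrier G"
    using sub h subgroup.subset by blast
  have "emeasure (count_space UNIV) {a \<in> gOmega G P ({h} \<times> B). gsrc a = x} \<le> of_nat (card ?C)" for x
  proof (cases "\<exists>k\<^sub>0\<in>carrier G. \<exists>y\<^sub>0\<in>pdom P (inv k\<^sub>0). y\<^sub>0 \<in> B \<and> x = pact P k\<^sub>0 y\<^sub>0")
    case True
    then obtain k\<^sub>0 y\<^sub>0 where 0: "k\<^sub>0 \<in> carrier G" "y\<^sub>0 \<in> pdom P (inv k\<^sub>0)" "y\<^sub>0 \<in> B" "x = pact P k\<^sub>0 y\<^sub>0"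
      by blast
    have sub_image: "{a \<in> gOmega G P ({h} \<times> B). gsrc a = x} \<subseteq> (\<lambda>c. (k\<^sub>0 \<otimes> c \<otimes> inv k\<^sub>0, x)) ` ?C"
    proof
      fix a assume "a \<in> {a \<in> gOmega G P ({h} \<times> B). gsrc a = x}"
      then obtain g where a: "a = (g, x)" "(g, x) \<in> gOmega G P ({h} \<times> B)"
        by (cases a) (auto simp: gsrc_def)
      then obtain k y where 1: "k \<in> carrier G" "y \<in> pdom P (inv k)" "y \<in> B" "g = k \<otimes> h \<otimes> inv k"
          "x = pact P k y"
        by (auto simp: gOmega_iff[OF B(2)])
      \<comment> \<open>This element carries \<open>y\<close> to \<open>y\<^sub>0\<close>. Both
        points lie in \<open>Y\<close>, so \<open>(?l, y)\<close> is an arrow of the restricted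
        groupoid and \<open>?l\<close> belongs to \<open>H\<close>.\<close>
      let ?l = "inv k\<^sub>0 \<otimes> k"
      have "pact P k y \<in> pdom P (inv (inv k\<^sub>0))"
        using 0 1 pact_mem by simp
      then have "y \<in> pdom P (inv ?l)" "pact P ?l y = y\<^sub>0"
        using pact_mult[of "inv k\<^sub>0" k y] 0 1 pact_inv_pact[of k\<^sub>0 y\<^sub>0] by auto
      then have "(?l, y) \<in> pgroupoid G (prestrict G P Y) (carrier G)"
        using 0 1 B(1) by (auto simp: pgroupoid_def prestrict_def)
      then have l: "?l \<in> H"
        using Y by (auto simp: pgroupoid_def)
      have "g = k\<^sub>0 \<otimes> (?l \<otimes> h \<otimes> inv ?l) \<otimes> inv k\<^sub>0"
        using 0 1 hc by (simp add: inv_mult_group m_assoc mult_inv_cancel)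
      then show "a \<in> (\<lambda>c. (k\<^sub>0 \<otimes> c \<otimes> inv k\<^sub>0, x)) ` ?C"
        using a l by blast
    qed
    have "finite {a \<in> gOmega G P ({h} \<times> B). gsrc a = x}"
      using fin sub_image by (rule finite_surj)
    moreover have "card {a \<in> gOmega G P ({h} \<times> B). gsrc a = x} \<le> card ?C"
      using fin sub_image by (rule surj_card_le)
    ultimately show ?thesis
      by simp
  next
    case False
    then have "{a \<in> gOmega G P ({h} \<times> B). gsrc a = x} = {}"
      by (auto simp: gsrc_def gOmega_iff[OF B(2)])
    then show ?thesis
      by (simp only: emeasure_empty zero_le)
  qed
  then have "mu_s M (gOmega G P ({h} \<times> B)) \<le> (\<integral>\<^sup>+ x. of_nat (card ?C) \<partial>M)"
    unfolding mu_s_def by (intro nn_integral_mono)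
  then show ?thesis
    by simp
qed

text \<open>The set \<open>{h} \<times> B\<close> over the domain \<open>B\<close> of
  \<open>h\<close> in \<open>Y\<close> is the counterexample. Source and target both send
  \<open>(h, y)\<close> to \<open>y\<close>, so it is a bisection of isotropy. The fibres of its
  \<Omega> are bounded by the size of the class, and it contains no unit.\<close>

lemma not_icc_if_finite_class:
  assumes "finite_measure M" and ind: "induced_from G M P H Y" and h: "h \<in> H" "h \<noteq> \<one>"
    and pos: "emeasure M (pdom (prestrict G P Y) (inv h)) \<noteq> 0"
    and triv: "acts_trivially_on G P h Y"
    and fin: "finite {k \<otimes> h \<otimes> inv k | k. k \<in> H}"
  shows "\<not> icc_groupoid G M P"
proof
  assume icc: "icc_groupoid G M P"
  interpret finite_measure M by fact
  have sub: "subgroup H G" and Y: "Y \<in> sets M"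
    and eq: "pgroupoid G (prestrict G P Y) (carrier G) = pgroupoid G (prestrict G P Y) H"
    using ind by (auto simp: induced_from_def)
  have hc: "h \<in> carrier G"
    using sub h subgroup.subset by blast
  define B where "B = pdom (prestrict G P Y) (inv h)"
  have B_iff: "x \<in> B \<longleftrightarrow> x \<in> pdom P (inv h) \<and> x \<in> Y \<and> pact P h x = x" for x
    using triv hc by (auto simp: B_def prestrict_def acts_trivially_on_def)
  \<comment> \<open>Invariance of \<open>Y\<close> under \<open>h\<close> makes the condition that
    \<open>pact P h x\<close> lies in \<open>Y\<close> automatic, which exhibits \<open>B\<close> as
    Borel.\<close>
  have "B = pdom P (inv h) \<inter> Y"
    using triv hc h(1) ind unfolding B_def prestrict_def induced_from_def invariant_set_def
    by auto
  then have B: "B \<in> sets M" "B \<subseteq> pdom P (inv h)" "B \<subseteq> Y"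
    using Y hc pdom_sets by auto
  have iso: "{h} \<times> B \<subseteq> giso G P"
    using hc by (auto simp: giso_iff B_iff)
  have "bisection P ({h} \<times> B)"
    by (auto simp: bisection_def inj_on_def gsrc_def gtgt_def B_iff)
  moreover have "mu_s M (gOmega G P ({h} \<times> B)) < \<infinity>"
  proof -
    have "mu_s M (gOmega G P ({h} \<times> B)) \<le>
        of_nat (card {k \<otimes> h \<otimes> inv k | k. k \<in> H}) * emeasure M (space M)"
      using mu_s_gOmega_section_le[OF sub _ h(1) B(3) iso fin] eq by simp
    also have "\<dots> < \<infinity>"
      by (simp add: ennreal_mult_less_top ennreal_of_nat_eq_real_of_nat emeasure_finite less_top[symmetric] ennreal_mult_eq_top_iff)
    finally show ?thesis .
  qed
  moreover have "mu_s M ({h} \<times> B) > 0"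
    using pos mu_s_section[OF B(1), of h] by (simp add: B_def zero_less_iff_neq_zero)
  ultimately have "mu_s M ({h} \<times> B - gunits G M) = 0"
    using icc iso gborel_section[OF hc B(1,2)] unfolding icc_groupoid_def by blast
  moreover have "{h} \<times> B - gunits G M = {h} \<times> B"
    using h by (auto simp: gunits_def)
  ultimately show False
    using pos mu_s_section[OF B(1), of h] by (simp add: B_def)
qed

section \<open>Measurability and finiteness of fibres\<close>

text \<open>Otherwise the countably many sections over elements other than \<open>\<one>\<close> are
  all null, and almost every fibre of \<open>A - gunits G M\<close> is empty.\<close>

lemma exists_nonunit_section:
  assumes A: "A \<in> gborel G M P" and nz: "mu_s M (A - gunits G M) \<noteq> 0"
  shows "\<exists>h\<in>carrier G - {\<one>}. emeasure M {x. (h, x) \<in> A} \<noteq> 0"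
proof (rule ccontr)
  assume "\<not> ?thesis"
  then have "AE x in M. (h, x) \<notin> A" if "h \<in> carrier G - {\<one>}" for h
    using that gborel_section_sets[OF A, of h]
    by (intro AE_I'[of "{x. (h, x) \<in> A}"]) auto
  then have "AE x in M. \<forall>h\<in>carrier G - {\<one>}. (h, x) \<notin> A"
    using countable_carrier by (subst AE_ball_countable) auto
  then have "AE x in M. emeasure (count_space UNIV) {a \<in> A - gunits G M. gsrc a = x} = 0"
  proof (rule AE_mp, intro AE_I2 impI)
    fix x assume x: "x \<in> space M" and *: "\<forall>h\<in>carrier G - {\<one>}. (h, x) \<notin> A"
    have "A \<subseteq> pgroupoid G P (carrier G)"
      using A by (auto simp: gborel_def sets_restrict_space)
    then have "{a \<in> A - gunits G M. gsrc a = x} = {}"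
      using x * by (auto simp: gunits_def gsrc_def pgroupoid_def)
    then show "emeasure (count_space UNIV) {a \<in> A - gunits G M. gsrc a = x} = 0"
      by (metis emeasure_empty)
  qed
  then have "mu_s M (A - gunits G M) = (\<integral>\<^sup>+ x. 0 \<partial>M)"
    unfolding mu_s_def by (rule nn_integral_cong_AE)
  then show False
    using nz by simp
qed

text \<open>Fibres of isotropy lie in \<open>carrier G\<close>, so equality with \<open>F\<close> is
  a countable conjunction of Borel conditions, one for each \<open>g\<close>.\<close>

lemma fibre_eq_sets:
  assumes W: "\<And>g. {x. (g, x) \<in> W} \<in> sets M" "W \<subseteq> giso G P" and F: "F \<subseteq> carrier G"
  shows "{x \<in> space M. {g. (g, x) \<in> W} = F} \<in> sets M"
proof -
  have "{x \<in> space M. {g. (g, x) \<in> W} = F} =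
      {x \<in> space M. \<forall>g\<in>carrier G. x \<in> {x. (g, x) \<in> W} \<longleftrightarrow> g \<in> F}"
    using W(2) F by (auto simp: giso_iff subset_iff)
  also have "\<dots> \<in> sets M"
    proof (rule sets.sets_Collect_countable_All'[OF _ countable_carrier])
    fix g
    have "{x \<in> space M. x \<in> {x. (g, x) \<in> W} \<longleftrightarrow> g \<in> F} =
        (if g \<in> F then space M \<inter> {x. (g, x) \<in> W} else space M - {x. (g, x) \<in> W})"
      by auto
    then show "{x \<in> space M. x \<in> {x. (g, x) \<in> W} \<longleftrightarrow> g \<in> F} \<in> sets M"
      using W(1)[of g] by auto
  qed
  finally show ?thesis .
qed

text \<open>\<open>mu_s\<close> integrates the cardinality of the fibres, and a finite integral
  forces the integrand to be finite almost everywhere.\<close>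

lemma finite_fibre_AE:
  assumes W: "\<And>g. {x. (g, x) \<in> W} \<in> sets M" "W \<subseteq> giso G P" and fin: "mu_s M W < \<infinity>"
  shows "AE x in M. finite {g. (g, x) \<in> W}"
proof -
  \<comment> \<open>Only countably many finite \<open>F\<close> exist, so writing the points with
    finite fibre as this union shows that they form a Borel set.\<close>
  let ?fin = "\<Union>F\<in>{F. finite F \<and> F \<subseteq> carrier G}. {x \<in> space M. {g. (g, x) \<in> W} = F}"
  define N where "N = space M - ?fin"
  have N_iff: "x \<in> N \<longleftrightarrow> x \<in> space M \<and> infinite {g. (g, x) \<in> W}" for x
    using W(2) by (auto simp: N_def giso_iff subset_iff)
  have N: "N \<in> sets M"
    unfolding N_def using W countable_carrier
    by (auto intro!: sets.Diff sets.countable_UN' fibre_eq_sets countable_Collect_finite_subset)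
  have "(\<integral>\<^sup>+ x. \<infinity> * indicator N x \<partial>M) \<le> mu_s M W"
    unfolding mu_s_def
  proof (rule nn_integral_mono)
    fix x
    show "\<infinity> * indicator N x \<le> emeasure (count_space UNIV) {a \<in> W. gsrc a = x}"
    proof (cases "x \<in> N")
      case True
      have "{g. (g, x) \<in> W} = fst ` {a \<in> W. gsrc a = x}"
        by (force simp: gsrc_def)
      then have "infinite {a \<in> W. gsrc a = x}"
        using True N_iff by auto
      then show ?thesis by simp
    qed simp
  qed
  then have "\<infinity> * emeasure M N < \<infinity>"
    using fin N by (simp add: nn_integral_cmult_indicator)
  \<comment> \<open>In \<open>ennreal\<close>, \<open>\<infinity>\<close> times a nonzero value is
    \<open>\<infinity>\<close>, while \<open>\<infinity> * 0 = 0\<close>.\<close>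
  then have "N \<in> null_sets M"
    using N by (auto simp: null_sets_def ennreal_top_mult split: if_splits)
  then show ?thesis
    by (rule AE_I') (auto simp: N_iff)
qed

text \<open>The countably many level sets of the fibre map at finite \<open>F\<close> cover almost
  all of \<open>B\<close>, so they cannot all meet \<open>B\<close> in a null set.\<close>

lemma exists_fibre_value:
  assumes W: "\<And>g. {x. (g, x) \<in> W} \<in> sets M" "W \<subseteq> giso G P" and fin: "mu_s M W < \<infinity>"
    and B: "B \<in> sets M" "emeasure M B \<noteq> 0"
  shows "\<exists>F. finite F \<and> F \<subseteq> carrier G \<and> emeasure M ({x \<in> space M. {g. (g, x) \<in> W} = F} \<inter> B) \<noteq> 0"
proof (rule ccontr)
  assume *: "\<not> ?thesis"
  have "AE x in M. x \<notin> {x \<in> space M. {g. (g, x) \<in> W} = F} \<inter> B"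
    if "F \<in> {F. finite F \<and> F \<subseteq> carrier G}" for F
    using that * fibre_eq_sets[OF W, of F] B
    by (intro AE_I'[of "{x \<in> space M. {g. (g, x) \<in> W} = F} \<inter> B"]) (auto simp: null_sets_def)
  then have "AE x in M. \<forall>F\<in>{F. finite F \<and> F \<subseteq> carrier G}.
      x \<notin> {x \<in> space M. {g. (g, x) \<in> W} = F} \<inter> B"
    using countable_carrier by (subst AE_ball_countable) (auto intro: countable_Collect_finite_subset)
  then have "AE x in M. x \<notin> B"
    using finite_fibre_AE[OF W fin]
  proof eventually_elim
    case (elim x)
    moreover have "{g. (g, x) \<in> W} \<subseteq> carrier G"
      using W(2) by (auto simp: giso_iff subset_iff)
    ultimately show ?case
      using B(1) sets.sets_into_space by blast
  qed
  then show False
    using B AE_iff_null_sets by (auto simp: null_sets_def)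
qed

section \<open>Fullness from ergodicity\<close>

text \<open>The saturation of \<open>Y\<close> is Borel and invariant under the orbit relation. It
  contains \<open>Y\<close>, so it is not null, and ergodicity makes it conull.\<close>

lemma full_set_if_ergodic:
  assumes erg: "ergodic_paction G M P" and Y: "Y \<in> sets M" "emeasure M Y \<noteq> 0"
  shows "full_set G M P Y"
proof -
  let ?S = "gtgt P ` {a \<in> pgroupoid G P (carrier G). gsrc a \<in> Y}"
  have S_eq: "?S = (\<Union>k\<in>carrier G. pact P k ` (Y \<inter> pdom P (inv k)))"
    by (force simp: gtgt_def gsrc_def pgroupoid_def)
  have S: "?S \<in> sets M"
    unfolding S_eq using countable_carrier Y(1) by (auto intro!: sets.countable_UN' pact_image_sets)
  have closed: "pact P g y \<in> ?S" if y: "g \<in> carrier G" "y \<in> pdom P (inv g)" "y \<in> ?S" for g y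
  proof -
    obtain k z where z: "k \<in> carrier G" "z \<in> Y" "z \<in> pdom P (inv k)" "y = pact P k z"
      using y(3) unfolding S_eq by blast
    have "g \<otimes> k \<in> carrier G" "z \<in> Y \<inter> pdom P (inv (g \<otimes> k))" "pact P g y = pact P (g \<otimes> k) z"
      using y z pact_mult[of g k z] by auto
    then show ?thesis
      unfolding S_eq by blast
  qed
  have "x \<in> ?S \<longleftrightarrow> y \<in> ?S" if R: "(x, y) \<in> orbit_rel G P" for x y
  proof -
    obtain g where g: "g \<in> carrier G" "y \<in> pdom P (inv g)" "x = pact P g y"
      using R by (auto simp: orbit_rel_def gtgt_def gsrc_def pgroupoid_def)
    \<comment> \<open>The inverse arrow leads from \<open>x\<close> back to \<open>y\<close>, so
      closure under arrows yields both directions of the equivalence.\<close>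
    have x: "x \<in> pdom P (inv (inv g))" "pact P (inv g) x = y"
      using g pact_mem pact_inv_pact by simp_all
    show ?thesis
      using closed[OF g(1,2), folded g(3)] closed[OF inv_closed[OF g(1)] x(1), unfolded x(2)]
      by (rule iffI[rotated])
  qed
  then have "?S \<in> null_sets M \<or> space M - ?S \<in> null_sets M"
    using erg[unfolded ergodic_paction_def ergodic_rel_def, rule_format, OF S] by blast
  moreover have "Y \<subseteq> ?S"
  proof
    fix y assume y: "y \<in> Y"
    then have "y \<in> space M"
      using Y sets.sets_into_space by blast
    then have "y = pact P \<one> y" "y \<in> pdom P (inv \<one>)"
      by (auto simp: pact_one pdom_one)
    then show "y \<in> ?S"
      unfolding S_eq using y by blast
  qed
  then have "?S \<notin> null_sets M"
    using Y null_sets_subset[of ?S M Y] by blast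
  ultimately have "space M - ?S \<in> null_sets M"
    by blast
  then show ?thesis
    unfolding full_set_def by (rule AE_I') blast
qed

section \<open>Stabilizers of finite sets and inducing\<close>

text \<open>This is the group to induce from. Equality of the image with \<open>F\<close>, rather
  than inclusion, ensures closure under inverses for infinite \<open>F\<close> too.\<close>

definition conj_stabilizer :: "'a set \<Rightarrow> 'a set" where
  "conj_stabilizer F = {k \<in> carrier G. (\<lambda>g. k \<otimes> g \<otimes> inv k) ` F = F}"

lemma conj_image_mult:
  assumes "F \<subseteq> carrier G" "k \<in> carrier G" "l \<in> carrier G"
  shows "(\<lambda>g. (k \<otimes> l) \<otimes> g \<otimes> inv (k \<otimes> l)) ` F =
    (\<lambda>g. k \<otimes> g \<otimes> inv k) ` (\<lambda>g. l \<otimes> g \<otimes> inv l) ` F"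
  unfolding image_image using assms
  by (intro image_cong refl) (auto simp: inv_mult_group m_assoc subset_iff)

lemma conj_image_one: "F \<subseteq> carrier G \<Longrightarrow> (\<lambda>g. \<one> \<otimes> g \<otimes> inv \<one>) ` F = F"
  by (force simp: subset_iff image_iff)

lemma subgroup_conj_stabilizer:
  assumes F: "F \<subseteq> carrier G"
  shows "subgroup (conj_stabilizer F) G"
proof
  show "conj_stabilizer F \<subseteq> carrier G"
    by (auto simp: conj_stabilizer_def)
  show "k \<otimes> l \<in> conj_stabilizer F" if "k \<in> conj_stabilizer F" "l \<in> conj_stabilizer F" for k l
    using that conj_image_mult[OF F] by (simp add: conj_stabilizer_def)
  show "\<one> \<in> conj_stabilizer F"
    using conj_image_one[OF F] by (simp add: conj_stabilizer_def)
  show "inv k \<in> conj_stabilizer F" if "k \<in> conj_stabilizer F" for k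
    using that conj_image_mult[OF F, of "inv k" k] conj_image_one[OF F]
    by (simp add: conj_stabilizer_def)
qed

text \<open>One inclusion is the invariance of \<open>W\<close> under \<open>k\<close>; the other is
  its invariance under \<open>inv k\<close>, applied at \<open>pact P k x\<close>.\<close>

lemma fibre_conj:
  assumes W: "W \<subseteq> giso G P"
    and inv: "\<And>g x k. (g, x) \<in> W \<Longrightarrow> k \<in> carrier G \<Longrightarrow> x \<in> pdom P (inv k) \<Longrightarrow>
                (k \<otimes> g \<otimes> inv k, pact P k x) \<in> W"
    and k: "k \<in> carrier G" "x \<in> pdom P (inv k)"
  shows "{g. (g, pact P k x) \<in> W} = (\<lambda>g. k \<otimes> g \<otimes> inv k) ` {g. (g, x) \<in> W}"
proof (intro equalityI subsetI)
  fix g assume g: "g \<in> {g. (g, pact P k x) \<in> W}"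
  then have gc: "g \<in> carrier G"
    using W by (auto simp: giso_iff subset_iff)
  have "(inv k \<otimes> g \<otimes> inv (inv k), pact P (inv k) (pact P k x)) \<in> W"
    using g k by (intro inv) (auto simp: pact_mem)
  then have "inv k \<otimes> g \<otimes> k \<in> {g. (g, x) \<in> W}"
    using k by (simp add: pact_inv_pact)
  moreover have "g = k \<otimes> (inv k \<otimes> g \<otimes> k) \<otimes> inv k"
    using gc k by (simp add: m_assoc mult_inv_cancel)
  ultimately show "g \<in> (\<lambda>g. k \<otimes> g \<otimes> inv k) ` {g. (g, x) \<in> W}"
    by blast
qed (use inv k in auto)

lemma induced_from_fibre_value:
  assumes erg: "ergodic_paction G M P"
    and W: "\<And>g. {x. (g, x) \<in> W} \<in> sets M" "W \<subseteq> giso G P"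
    and inv: "\<And>g x k. (g, x) \<in> W \<Longrightarrow> k \<in> carrier G \<Longrightarrow> x \<in> pdom P (inv k) \<Longrightarrow>
                (k \<otimes> g \<otimes> inv k, pact P k x) \<in> W"
    and F: "F \<subseteq> carrier G"
    and Y_def: "Y = {x \<in> space M. {g. (g, x) \<in> W} = F}" and pos: "emeasure M Y \<noteq> 0"
  shows "induced_from G M P (conj_stabilizer F) Y"
proof -
  note conj = fibre_conj[OF W(2) inv]
  have Y: "Y \<in> sets M"
    unfolding Y_def using W F by (rule fibre_eq_sets)
  \<comment> \<open>The fibre over \<open>pact P k y\<close> is the conjugate of \<open>F\<close> by
    \<open>k\<close>, so it equals \<open>F\<close> exactly when \<open>k\<close> stabilizes
    \<open>F\<close>. Both the invariance of \<open>Y\<close> and the equality of the two groupoids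
    follow from this.\<close>
  have closed: "pact P k y \<in> Y \<longleftrightarrow> k \<in> conj_stabilizer F"
    if "k \<in> carrier G" "y \<in> pdom P (inv k)" "y \<in> Y" for k y
    using that conj[of k y] pact_mem[of k y] pdom_space[of k "pact P k y"]
    by (auto simp: Y_def conj_stabilizer_def)
  have sub: "subgroup (conj_stabilizer F) G"
    using F by (rule subgroup_conj_stabilizer)
  have "invariant_set G P (conj_stabilizer F) Y"
    unfolding invariant_set_def
  proof (intro ballI equalityI subsetI)
    fix k x assume k: "k \<in> conj_stabilizer F"
    then have kc: "k \<in> carrier G"
      by (simp add: conj_stabilizer_def)
    show "x \<in> Y \<inter> pdom P k" if "x \<in> pact P k ` (Y \<inter> pdom P (inv k))"
      using that k kc closed pact_mem by auto
    assume x: "x \<in> Y \<inter> pdom P k"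
    then have "pact P (inv k) x \<in> Y \<inter> pdom P (inv k)"
      using kc k closed[of "inv k" x] subgroup.m_inv_closed[OF sub k] pact_inv_mem by simp
    then show "x \<in> pact P k ` (Y \<inter> pdom P (inv k))"
      using x kc pact_pact_inv[of k x] by force
  qed
  moreover have "pgroupoid G (prestrict G P Y) (carrier G) =
      pgroupoid G (prestrict G P Y) (conj_stabilizer F)"
    using closed subgroup.subset[OF sub]
    by (auto simp: pgroupoid_def prestrict_def)
  ultimately show ?thesis
    using sub Y full_set_if_ergodic[OF erg Y pos] by (simp add: induced_from_def)
qed

section \<open>From failure of icc to a finite class\<close>

lemma exists_finite_class_if_not_icc:
  assumes erg: "ergodic_paction G M P" and nicc: "\<not> icc_groupoid G M P"
  shows "\<exists>H Y h. induced_from G M P H Y \<and> h \<in> H - {\<one>} \<and>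
    emeasure M (pdom (prestrict G P Y) (inv h)) \<noteq> 0 \<and> acts_trivially_on G P h Y \<and>
    finite {k \<otimes> h \<otimes> inv k | k. k \<in> H}"
proof -
  obtain A where A: "A \<in> gborel G M P" "A \<subseteq> giso G P"
      and fin: "mu_s M (gOmega G P A) < \<infinity>" and nz: "mu_s M (A - gunits G M) \<noteq> 0"
    using nicc unfolding icc_groupoid_def by blast
  define W where "W = gOmega G P A"
  have W: "\<And>g. {x. (g, x) \<in> W} \<in> sets M" "W \<subseteq> giso G P"
    using gOmega_section_sets[OF A] gOmega_subset_giso[OF A(2)] by (auto simp: W_def)
  have conj: "(k \<otimes> g \<otimes> inv k, pact P k x) \<in> W"
    if "(g, x) \<in> W" "k \<in> carrier G" "x \<in> pdom P (inv k)" for g x k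
    using gOmega_conj[OF A(2)] that by (simp add: W_def)
  obtain h where h: "h \<in> carrier G" "h \<noteq> \<one>" "emeasure M {x. (h, x) \<in> A} \<noteq> 0"
    using exists_nonunit_section[OF A(1) nz] by blast
  \<comment> \<open>\<open>F\<close> is chosen so that its level set meets the section of
    \<open>A\<close> over \<open>h\<close>; this is what later places \<open>h\<close> in
    \<open>F\<close>.\<close>
  obtain F where F: "finite F" "F \<subseteq> carrier G"
      "emeasure M ({x \<in> space M. {g. (g, x) \<in> W} = F} \<inter> {x. (h, x) \<in> A}) \<noteq> 0"
    using exists_fibre_value[OF W _ gborel_section_sets[OF A(1)] h(3)] fin by (auto simp: W_def)
  define Y where "Y = {x \<in> space M. {g. (g, x) \<in> W} = F}"
  have Y: "Y \<in> sets M"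
    unfolding Y_def using W F(2) by (rule fibre_eq_sets)
  have pos: "emeasure M Y \<noteq> 0"
    using F(3) emeasure_mono[of "Y \<inter> {x. (h, x) \<in> A}" Y M] Y by (auto simp: Y_def)
  have ind: "induced_from G M P (conj_stabilizer F) Y"
    using erg W conj F(2) Y_def pos by (rule induced_from_fibre_value)
  have "Y \<inter> {x. (h, x) \<in> A} \<noteq> {}"
    using F(3) by (metis Y_def emeasure_empty)
  then have hF: "h \<in> F"
    using subset_gOmega[OF A(2)] by (auto simp: Y_def W_def)
  \<comment> \<open>Since \<open>h\<close> belongs to the fibre over every \<open>y\<close> in
    \<open>Y\<close>, each \<open>(h, y)\<close> is an isotropy arrow. Hence \<open>h\<close> is
    defined on all of \<open>Y\<close> and fixes it pointwise.\<close>
  have Y_fix: "y \<in> pdom P (inv h) \<and> pact P h y = y" if "y \<in> Y" for y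
    using that hF W(2) by (auto simp: Y_def giso_iff subset_iff)
  have dom: "pdom (prestrict G P Y) (inv h) = Y"
    using Y_fix h(1) by (auto simp: prestrict_def)
  obtain y where "y \<in> Y"
    using pos by fastforce
  \<comment> \<open>As \<open>h\<close> fixes \<open>y\<close>, the fibre over
    \<open>pact P h y\<close> is \<open>F\<close> itself, and by equivariance it is also the
    conjugate of \<open>F\<close> by \<open>h\<close>.\<close>
  then have hH: "h \<in> conj_stabilizer F"
    using fibre_conj[OF W(2) conj h(1), of y] Y_fix[of y] h(1)
    by (auto simp: Y_def conj_stabilizer_def)
  have "{k \<otimes> h \<otimes> inv k | k. k \<in> conj_stabilizer F} \<subseteq> F"
    using hF by (auto simp: conj_stabilizer_def)
  then have "finite {k \<otimes> h \<otimes> inv k | k. k \<in> conj_stabilizer F}"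
    using F(1) by (rule finite_subset)
  moreover have "acts_trivially_on G P h Y"
    using Y_fix by (auto simp: acts_trivially_on_def dom)
  ultimately show ?thesis
    using ind hH h(2) pos dom
    by (intro exI[of _ "conj_stabilizer F"] exI[of _ Y] exI[of _ h]) auto
qed

end

theorem theorem6p16:
  fixes G :: "('g, 'm) monoid_scheme" and \<mu> :: "'x measure" and P :: "('g, 'x) paction"
  assumes "group G" and "countable (carrier G)"
    and "standard_borel \<mu>" and "prob_space \<mu>"
    and "partial_action G \<mu> P"
    and "nonsingular_paction G \<mu> P"
    and "ergodic_paction G \<mu> P"
  shows "(\<forall>H Y h. induced_from G \<mu> P H Y \<and> h \<in> H - {\<one>\<^bsub>G\<^esub>} \<and>
             emeasure \<mu> (pdom (prestrict G P Y) (inv\<^bsub>G\<^esub> h)) \<noteq> 0 \<and>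
             acts_trivially_on G P h Y \<longrightarrow>
             infinite {k \<otimes>\<^bsub>G\<^esub> h \<otimes>\<^bsub>G\<^esub> inv\<^bsub>G\<^esub> k | k. k \<in> H})
         \<longleftrightarrow> icc_groupoid G \<mu> P"
proof -
  interpret group G by fact
  interpret countable_partial_action G \<mu> P
    using assms by unfold_locales auto
  interpret prob_space \<mu> by fact
  show ?thesis
    using not_icc_if_finite_class[OF finite_measure_axioms]
      exists_finite_class_if_not_icc[OF \<open>ergodic_paction G \<mu> P\<close>]
    by blast
qed

end
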